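(* Let $n\geq 2$, let $\mathbb{K}$ be a field of characteristic different from $2$, and let $m\geq 1$. An $m$-fold extension $f\colon\mathscr{B}\to\mathscr{A}$ in the category of Lie $n$-algebras over $\mathbb{K}$ is central (with respect to the subcategory of $\mathbb{K}$-vector spaces, i.e. abelian Lie $n$-algebras) if and only if the object $$\sum_{I_{1}\cup\dots\cup I_{n}=\langle m\rangle}\Bigl[\bigcap_{i\in I_{1}}K[f_{i}],\dots,\bigcap_{i\in I_{n}}K[f_{i}]\Bigr]$$ is zero.
   Context: A Lie $n$-algebra over $\mathbb{K}$ is a $\mathbb{K}$-vector space $\mathscr{L}$ with an $n$-linear operation $[-,\dots,-]\colon\mathscr{L}^n\to\mathscr{L}$ satisfying $$[[l_{1},\dots,l_{n}],l'_{1},\dots,l'_{n-1}]=\sum_{1\leq i\leq n}[l_{1},\dots,l_{i-1},[l_{i},l'_{1},\dots,l'_{n-1}],l_{i+1},\dots,l_{n}]$$ and $[l_1,\dots,l_n]=\mathrm{sgn}(\sigma)[l_{\sigma(1)},\dots,l_{\sigma(n)}]$ for all permutations $\sigma\in S_n$. Homomorphisms are linear maps preserving the bracket. Ideals are subspaces $\mathscr{N}$ such that $[l_1,\dots,l_n]\in\mathscr{N}$ whenever some $l_i\in\mathscr{N}$. A vector space is regarded as a Lie $n$-algebra with zero bracket ("abelian"). For ideals $\mathscr{N}_1,\dots,\mathscr{N}_n$ of $\mathscr{L}$, $[\mathscr{N}_1,\dots,\mathscr{N}_n]$ denotes the ideal of $\mathscr{L}$ generated by the elements $[l_1,\dots,l_n]$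 with $l_1\in\mathscr{N}_1,\dots,l_n\in\mathscr{N}_n$. The left adjoint of the inclusion of vector spaces into Lie $n$-algebras is $\mathscr{L}\mapsto\mathscr{L}/[\mathscr{L},\dots,\mathscr{L}]$. Higher extensions. Let $\langle m\rangle=\{1,\dots,m\}$, $\langle 0\rangle=\varnothing$. An $m$-fold arrow is a functor $f$ from the poset of subsets of $\langle m\rangle$ (ordered by inclusion) to the category; write $f_I=f(I)$, and $f_i\colon f_\varnothing\to f_{\{i\}}$ for the map induced by $\varnothing\subseteq\{i\}$; $K[f_i]$ is the kernel of $f_i$, an ideal of $f_\varnothing$. An $m$-fold arrow $f$ is an $m$-fold extension if for all $I\subsetneq\langle m\rangle$ the induced map $f_I\to\lim_{J\supsetneq I}f_J$ is surjective; a $0$-fold extension is just an object. For $m\geq1$, $f$ is viewed as a morphism $f\colon\mathscr{B}\to\mathscr{A}$ of $(m-1)$-fold arrows, with $\mathscr{B}_I=f_I$ and $\mathscr{A}_I=f_{I\cup\{m\}}$ for $I\subseteq\langle m-1\rangle$. Its kernel pair $R[f]$ is the $(m-1)$-fold extension with $R[f]_I=\{(x,y)\in\mathscr{B}_I\times\mathscr{B}_I$ : $x,y$ have the same image in $\mathscr{A}_I\}$, with projections $f_0,f_1\colon R[f]\to\mathscr{B}$ onto the first and second component. Higher centrality. Define inductively, for an $m$-fold extension $f$, an ideal $L_m[f]$ of $f_\varnothing$: $L_0[\mathscr{L}]=[\mathscr{L},\dots,\mathscr{L}]$, and for $m\geq 1$, $L_m[f]$ is the kernel of the restriction $L_{m-1}[R[f]]\to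 L_{m-1}[\mathscr{B}]$ of $(f_0)_\varnothing\colon R[f]_\varnothing\to\mathscr{B}_\varnothing$, viewed as an ideal of $f_\varnothing=\mathscr{B}_\varnothing$ via $(f_1)_\varnothing$; that is, $L_m[f]=\{k\in f_\varnothing:(0,k)\in L_{m-1}[R[f]]\}$. The $m$-fold extension $f$ is central if and only if the restrictions of $(f_0)_\varnothing$ and $(f_1)_\varnothing$ to maps $L_{m-1}[R[f]]\to L_{m-1}[\mathscr{B}]$ coincide. The sum in the claim is a sum of ideals of $f_\varnothing$, over all $n$-tuples $(I_1,\dots,I_n)$ of (possibly empty) subsets of $\langle m\rangle$ with union $\langle m\rangle$; an empty intersection means $f_\varnothing$. *)

theory Defs
  imports "HOL-Combinatorics.Permutations" "HOL-Algebra.Module" "HOL-Algebra.AbelCoset"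
begin

section \<open>Lie n-algebras\<close>

text \<open>The \<open>n\<close> arguments of the bracket form a list of length \<open>n\<close>. As for the library's
  modules, the ring components \<open>mult\<close> and \<open>one\<close> of the record are unused.\<close>

record ('k, 'v) lie_alg = "('k, 'v) module" +
  bracket :: "'v list \<Rightarrow> 'v"

locale lie_n_algebra = field K + module K L
  for n :: nat and K :: "('k, 'c) ring_scheme" and L :: "('k, 'v) lie_alg" +
  assumes bracket_closed:
      "\<And>ls. length ls = n \<Longrightarrow> set ls \<subseteq> carrier L \<Longrightarrow> bracket L ls \<in> carrier L"
    and bracket_add:
      "\<And>ls i x y. length ls = n \<Longrightarrow> set ls \<subseteq> carrier L \<Longrightarrow> i < n \<Longrightarrow>
        x \<in> carrier L \<Longrightarrow> y \<in> carrier L \<Longrightarrow>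
        bracket L (ls[i := x \<oplus>\<^bsub>L\<^esub> y]) = bracket L (ls[i := x]) \<oplus>\<^bsub>L\<^esub> bracket L (ls[i := y])"
    and bracket_smult:
      "\<And>ls i a x. length ls = n \<Longrightarrow> set ls \<subseteq> carrier L \<Longrightarrow> i < n \<Longrightarrow>
        a \<in> carrier K \<Longrightarrow> x \<in> carrier L \<Longrightarrow>
        bracket L (ls[i := a \<odot>\<^bsub>L\<^esub> x]) = a \<odot>\<^bsub>L\<^esub> bracket L (ls[i := x])"
    and bracket_derivation:
      "\<And>ls ls'. length ls = n \<Longrightarrow> set ls \<subseteq> carrier L \<Longrightarrow>
        length ls' = n - 1 \<Longrightarrow> set ls' \<subseteq> carrier L \<Longrightarrow>
        bracket L (bracket L ls # ls') =
          (\<Oplus>\<^bsub>L\<^esub>i\<in>{..<n}. bracket L (ls[i := bracket L (ls ! i # ls')]))"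
    and bracket_permute:
      "\<And>ls \<sigma>. length ls = n \<Longrightarrow> set ls \<subseteq> carrier L \<Longrightarrow> \<sigma> permutes {..<n} \<Longrightarrow>
        bracket L ls = [sign \<sigma>] \<cdot>\<^bsub>L\<^esub> bracket L (permute_list \<sigma> ls)"

definition lie_hom ::
    "nat \<Rightarrow> ('k, 'c) ring_scheme \<Rightarrow> ('k, 'v) lie_alg \<Rightarrow> ('k, 'w) lie_alg \<Rightarrow> ('v \<Rightarrow> 'w) set" where
  "lie_hom n K L M = {h. h \<in> carrier L \<rightarrow> carrier M \<and>
     (\<forall>x\<in>carrier L. \<forall>y\<in>carrier L. h (x \<oplus>\<^bsub>L\<^esub> y) = h x \<oplus>\<^bsub>M\<^esub> h y) \<and>
     (\<forall>a\<in>carrier K. \<forall>x\<in>carrier L. h (a \<odot>\<^bsub>L\<^esub> x) = a \<odot>\<^bsub>M\<^esub> h x) \<and>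
     (\<forall>ls. length ls = n \<longrightarrow> set ls \<subseteq> carrier L \<longrightarrow> h (bracket L ls) = bracket M (map h ls))}"

definition lie_ideal ::
    "nat \<Rightarrow> ('k, 'c) ring_scheme \<Rightarrow> ('k, 'v) lie_alg \<Rightarrow> 'v set \<Rightarrow> bool" where
  "lie_ideal n K L N \<longleftrightarrow> submodule N K L \<and>
     (\<forall>ls. length ls = n \<longrightarrow> set ls \<subseteq> carrier L \<longrightarrow> (\<exists>i<n. ls ! i \<in> N) \<longrightarrow> bracket L ls \<in> N)"

definition gen_lie_ideal ::
    "nat \<Rightarrow> ('k, 'c) ring_scheme \<Rightarrow> ('k, 'v) lie_alg \<Rightarrow> 'v set \<Rightarrow> 'v set" where
  "gen_lie_ideal n K L S = \<Inter>{N. lie_ideal n K L N \<and> S \<subseteq> N}"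

text \<open>The ideal \<open>[N\<^sub>1, \<dots>, N\<^sub>n]\<close>, for a list \<open>Ns\<close> of length \<open>n\<close>. The set \<open>listset Ns\<close> consists of
  the lists \<open>[l\<^sub>1, \<dots>, l\<^sub>n]\<close> with \<open>l\<^sub>i \<in> N\<^sub>i\<close>.\<close>

definition bracket_ideal ::
    "nat \<Rightarrow> ('k, 'c) ring_scheme \<Rightarrow> ('k, 'v) lie_alg \<Rightarrow> 'v set list \<Rightarrow> 'v set" where
  "bracket_ideal n K L Ns = gen_lie_ideal n K L (bracket L ` listset Ns)"

definition sum_family :: "('k, 'v) lie_alg \<Rightarrow> 't set \<Rightarrow> ('t \<Rightarrow> 'v set) \<Rightarrow> 'v set" where
  "sum_family L T N = {(\<Oplus>\<^bsub>L\<^esub>t\<in>T. x t) | x. x \<in> Pi T N}"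


section \<open>Higher arrows and higher extensions\<close>

text \<open>A functor on the poset of subsets of \<open>{1..m}\<close>; \<open>mor f I J\<close> is the map \<open>f\<^sub>I \<rightarrow> f\<^sub>J\<close>
  induced by \<open>I \<subseteq> J\<close>. Values outside this poset are irrelevant. Using one
  carrier type for the finitely many objects is no restriction, as carriers are
  subsets of that type.\<close>

record ('k, 'v) arrow =
  obj :: "nat set \<Rightarrow> ('k, 'v) lie_alg"
  mor :: "nat set \<Rightarrow> nat set \<Rightarrow> 'v \<Rightarrow> 'v"

definition fold_arrow ::
    "nat \<Rightarrow> ('k, 'c) ring_scheme \<Rightarrow> nat \<Rightarrow> ('k, 'v) arrow \<Rightarrow> bool" where
  "fold_arrow n K m f \<longleftrightarrow>
     (\<forall>I. I \<subseteq> {1..m} \<longrightarrow> lie_n_algebra n K (obj f I)) \<and>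
     (\<forall>I J. I \<subseteq> J \<longrightarrow> J \<subseteq> {1..m} \<longrightarrow> mor f I J \<in> lie_hom n K (obj f I) (obj f J)) \<and>
     (\<forall>I. I \<subseteq> {1..m} \<longrightarrow> (\<forall>x\<in>carrier (obj f I). mor f I I x = x)) \<and>
     (\<forall>H I J. H \<subseteq> I \<longrightarrow> I \<subseteq> J \<longrightarrow> J \<subseteq> {1..m} \<longrightarrow>
        (\<forall>x\<in>carrier (obj f H). mor f I J (mor f H I x) = mor f H J x))"

text \<open>The carrier of the limit of the \<open>f\<^sub>J\<close> over all \<open>J \<subseteq> {1..m}\<close> properly containing \<open>I\<close>:
  the compatible families.\<close>

definition strict_limit :: "nat \<Rightarrow> ('k, 'v) arrow \<Rightarrow> nat set \<Rightarrow> (nat set \<Rightarrow> 'v) set" where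
  "strict_limit m f I =
     {x \<in> (\<Pi>\<^sub>E J\<in>{J. I \<subset> J \<and> J \<subseteq> {1..m}}. carrier (obj f J)).
        \<forall>J J'. I \<subset> J \<longrightarrow> J \<subseteq> J' \<longrightarrow> J' \<subseteq> {1..m} \<longrightarrow> mor f J J' (x J) = x J'}"

definition fold_extension ::
    "nat \<Rightarrow> ('k, 'c) ring_scheme \<Rightarrow> nat \<Rightarrow> ('k, 'v) arrow \<Rightarrow> bool" where
  "fold_extension n K m f \<longleftrightarrow> fold_arrow n K m f \<and>
     (\<forall>I. I \<subset> {1..m} \<longrightarrow>
        (\<lambda>a. \<lambda>J\<in>{J. I \<subset> J \<and> J \<subseteq> {1..m}}. mor f I J a) ` carrier (obj f I) = strict_limit m f I)"

definition arrow_kernel :: "('k, 'v) arrow \<Rightarrow> nat \<Rightarrow> 'v set" where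
  "arrow_kernel f i = a_kernel (obj f {}) (obj f {i}) (mor f {} {i})"

text \<open>The intersection with the carrier gives the empty intersection its intended value.\<close>

definition kernel_inter :: "('k, 'v) arrow \<Rightarrow> nat set \<Rightarrow> 'v set" where
  "kernel_inter f I = carrier (obj f {}) \<inter> (\<Inter>i\<in>I. arrow_kernel f i)"

definition kernel_bracket_sum ::
    "nat \<Rightarrow> ('k, 'c) ring_scheme \<Rightarrow> nat \<Rightarrow> ('k, 'v) arrow \<Rightarrow> 'v set" where
  "kernel_bracket_sum n K m f =
     sum_family (obj f {}) {Is. length Is = n \<and> \<Union>(set Is) = {1..m}}
       (\<lambda>Is. bracket_ideal n K (obj f {}) (map (kernel_inter f) Is))"


section \<open>Kernel pairs and higher centrality\<close>

text \<open>Iterated kernel pairs consist of nested pairs of varying depth. Since a recursive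
  definition cannot change its type from one step to the next, all these nested pairs are
  collected in one type.\<close>

datatype 'v nested = Leaf (unleaf: 'v) | Node (left: "'v nested") (right: "'v nested")

definition leaf_alg :: "('k, 'v) lie_alg \<Rightarrow> ('k, 'v nested) lie_alg" where
  "leaf_alg L =
     \<lparr>carrier = Leaf ` carrier L,
      mult = undefined, one = undefined,
      ring.zero = Leaf \<zero>\<^bsub>L\<^esub>,
      add = (\<lambda>x y. Leaf (unleaf x \<oplus>\<^bsub>L\<^esub> unleaf y)),
      smult = (\<lambda>a x. Leaf (a \<odot>\<^bsub>L\<^esub> unleaf x)),
      bracket = (\<lambda>ls. Leaf (bracket L (map unleaf ls)))\<rparr>"

definition leaf_arrow :: "('k, 'v) arrow \<Rightarrow> ('k, 'v nested) arrow" where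
  "leaf_arrow f =
     \<lparr>obj = (\<lambda>I. leaf_alg (obj f I)),
      mor = (\<lambda>I J x. Leaf (mor f I J (unleaf x)))\<rparr>"

text \<open>For an \<open>m\<close>-fold arrow \<open>f\<close> with \<open>m \<ge> 1\<close>, regarded as a morphism of \<open>(m - 1)\<close>-fold arrows
  in direction \<open>m\<close>, the kernel pair is an \<open>(m - 1)\<close>-fold arrow. Its two projections at
  the empty set are \<open>left\<close> and \<open>right\<close>.\<close>

definition kernel_pair :: "nat \<Rightarrow> ('k, 'v nested) arrow \<Rightarrow> ('k, 'v nested) arrow" where
  "kernel_pair m f =
     \<lparr>obj = (\<lambda>I.
        \<lparr>carrier = {Node x y | x y. x \<in> carrier (obj f I) \<and> y \<in> carrier (obj f I) \<and>
                      mor f I (insert m I) x = mor f I (insert m I) y},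
         mult = undefined, one = undefined,
         ring.zero = Node \<zero>\<^bsub>obj f I\<^esub> \<zero>\<^bsub>obj f I\<^esub>,
         add = (\<lambda>z w. Node (left z \<oplus>\<^bsub>obj f I\<^esub> left w) (right z \<oplus>\<^bsub>obj f I\<^esub> right w)),
         smult = (\<lambda>a z. Node (a \<odot>\<^bsub>obj f I\<^esub> left z) (a \<odot>\<^bsub>obj f I\<^esub> right z)),
         bracket = (\<lambda>zs. Node (bracket (obj f I) (map left zs))
                              (bracket (obj f I) (map right zs)))\<rparr>),
      mor = (\<lambda>I J z. Node (mor f I J (left z)) (mor f I J (right z)))\<rparr>"

text \<open>The ideal \<open>L\<^sub>m[f]\<close> of \<open>f\<^sub>\<emptyset>\<close>.\<close>

primrec central_ideal ::
    "nat \<Rightarrow> ('k, 'c) ring_scheme \<Rightarrow> nat \<Rightarrow> ('k, 'v nested) arrow \<Rightarrow> 'v nested set" where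
  "central_ideal n K 0 f = bracket_ideal n K (obj f {}) (replicate n (carrier (obj f {})))"
| "central_ideal n K (Suc m) f =
     {k \<in> carrier (obj f {}). Node \<zero>\<^bsub>obj f {}\<^esub> k \<in> central_ideal n K m (kernel_pair (Suc m) f)}"

text \<open>Centrality of an \<open>m\<close>-fold extension, for \<open>m \<ge> 1\<close> only: the two projections agree on
  \<open>L\<^sub>m\<^sub>-\<^sub>1[R[f]]\<close>.\<close>

definition central_extension ::
    "nat \<Rightarrow> ('k, 'c) ring_scheme \<Rightarrow> nat \<Rightarrow> ('k, 'v) arrow \<Rightarrow> bool" where
  "central_extension n K m f \<longleftrightarrow>
     (\<forall>z\<in>central_ideal n K (m - 1) (kernel_pair m (leaf_arrow f)). left z = right z)"

end

theory Submission
  imports Defs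
begin

text \<open>For a cover \<open>I\<^sub>1 \<union> \<dots> \<union> I\<^sub>n = {1..m}\<close>, consider the brackets \<open>[x\<^sub>1, \<dots>, x\<^sub>n]\<close> where each \<open>x\<^sub>i\<close>
  lies in the kernels \<open>K[f\<^sub>j]\<close> for all \<open>j \<in> I\<^sub>i\<close>. These brackets generate the ideal in the theorem, so
  that ideal is zero if and only if they all vanish (\<open>kernel_bracket_sum_zero_iff\<close>). The
  theorem therefore compares \<open>L\<^sub>m[f]\<close> with these brackets. The comparison is an induction on \<open>m\<close>
  along kernel pairs, driven by multilinearity of the bracket.

  On the one hand, \<open>L\<^sub>m[f]\<close> contains all these brackets
  (\<open>kernel_brackets_subset_central_ideal\<close>): lifting \<open>x\<^sub>i\<close> to \<open>(0, x\<^sub>i)\<close> or \<open>(x\<^sub>i, x\<^sub>i)\<close>, according to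
  whether \<open>m \<in> I\<^sub>i\<close>, exhibits \<open>(0, [x\<^sub>1, \<dots>, x\<^sub>n])\<close> as a bracket of the same kind in the kernel
  pair, for a cover of \<open>{1..m - 1}\<close>.

  On the other hand, \<open>L\<^sub>m[f]\<close> is contained in every submodule \<open>T\<close> that contains these brackets
  (\<open>central_ideal_subset\<close>). The pairs in the kernel pair whose difference lies in \<open>T\<close> form
  a submodule. It contains the brackets belonging to the kernel pair, because the difference
  \<open>[y\<^sub>1, \<dots>, y\<^sub>n] - [x\<^sub>1, \<dots>, x\<^sub>n]\<close> telescopes into brackets with one argument \<open>y\<^sub>i - x\<^sub>i\<close>, which lies
  in the additional kernel \<open>K[f\<^sub>m]\<close> (\<open>kernel_brackets_kernel_pair_diff\<close>). By induction it
  contains \<open>L\<^sub>m\<^sub>-\<^sub>1\<close> of the kernel pair, and a pair \<open>(0, k)\<close> in it has \<open>k \<in> T\<close>.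

  Centrality says that the two projections agree on \<open>L\<^sub>m\<^sub>-\<^sub>1\<close> of the kernel pair. The first fact
  shows that then every bracket is zero; the second, with \<open>T = 0\<close>, gives the converse
  (\<open>projections_agree_iff\<close>).\<close>

section \<open>Lie n-algebras and their homomorphisms\<close>

lemma lie_homD:
  assumes "h \<in> lie_hom n K L M"
  shows "x \<in> carrier L \<Longrightarrow> h x \<in> carrier M"
    and "x \<in> carrier L \<Longrightarrow> y \<in> carrier L \<Longrightarrow> h (x \<oplus>\<^bsub>L\<^esub> y) = h x \<oplus>\<^bsub>M\<^esub> h y"
    and "a \<in> carrier K \<Longrightarrow> x \<in> carrier L \<Longrightarrow> h (a \<odot>\<^bsub>L\<^esub> x) = a \<odot>\<^bsub>M\<^esub> h x"
    and "length ls = n \<Longrightarrow> set ls \<subseteq> carrier L \<Longrightarrow> h (bracket L ls) = bracket M (map h ls)"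
  using assms by (auto simp: lie_hom_def)

lemma lie_n_algebra_abelian_group:
  assumes "lie_n_algebra n K L"
  shows "abelian_group L"
  using assms by (auto simp: lie_n_algebra_def module_def)

lemma lie_hom_abelian_group_hom:
  assumes "abelian_group L" "abelian_group M" "h \<in> lie_hom n K L M"
  shows "abelian_group_hom L M h"
  using assms
  by (intro abelian_group_homI group_hom.intro group_hom_axioms.intro abelian_group.a_group)
     (auto simp: hom_def lie_homD)

lemma (in abelian_group_hom) hom_finsum:
  assumes "f \<in> A \<rightarrow> carrier G"
  shows "h (\<Oplus>\<^bsub>G\<^esub>i\<in>A. f i) = (\<Oplus>\<^bsub>H\<^esub>i\<in>A. h (f i))"
  using assms by (induct A rule: infinite_finite_induct) (auto simp: Pi_def)

lemma (in abelian_group_hom) hom_add_pow_int: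
  assumes "x \<in> carrier G"
  shows "h ([k] \<cdot>\<^bsub>G\<^esub> x) = [(k::int)] \<cdot>\<^bsub>H\<^esub> h x"
  using group_hom.hom_int_pow[OF a_group_hom, of x k] assms by (simp add: add_pow_def)

text \<open>Lie n-algebras are defined by identities, and an identity holds in \<open>M\<close> as soon as it
  holds after applying each map of a jointly injective family of homomorphisms to a Lie
  n-algebra. Kernel pairs, with their two projections, and copies along \<open>Leaf\<close> are both instances.
  The arity has to be positive: the derivation identity brackets a list of length
  \<open>1 + (n - 1)\<close>, and homomorphisms control the bracket only on lists of length \<open>n\<close>.\<close>

lemma lie_n_algebra_if_separated:
  fixes L :: "('k, 'v) lie_alg" and M :: "('k, 'w) lie_alg"
  assumes n: "n > 0"
    and L: "lie_n_algebra n K L"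
    and hom: "H \<subseteq> lie_hom n K M L"
    and separated: "\<And>x y. x \<in> carrier M \<Longrightarrow> y \<in> carrier M \<Longrightarrow> \<forall>h\<in>H. h x = h y \<Longrightarrow> x = y"
    and zero: "\<zero>\<^bsub>M\<^esub> \<in> carrier M" "\<And>h. h \<in> H \<Longrightarrow> h \<zero>\<^bsub>M\<^esub> = \<zero>\<^bsub>L\<^esub>"
    and add: "\<And>x y. x \<in> carrier M \<Longrightarrow> y \<in> carrier M \<Longrightarrow> x \<oplus>\<^bsub>M\<^esub> y \<in> carrier M"
    and smult: "\<And>a x. a \<in> carrier K \<Longrightarrow> x \<in> carrier M \<Longrightarrow> a \<odot>\<^bsub>M\<^esub> x \<in> carrier M"
    and bracket: "\<And>ls. length ls = n \<Longrightarrow> set ls \<subseteq> carrier M \<Longrightarrow> bracket M ls \<in> carrier M"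
  shows "lie_n_algebra n K M"
proof -
  interpret L: lie_n_algebra n K L by fact
  note [simp] = zero add smult
  have h_closed [simp]: "h x \<in> carrier L" if "h \<in> H" "x \<in> carrier M" for h x
    using that by (intro lie_homD(1)[OF subsetD[OF hom]])
  have h_add [simp]: "h (x \<oplus>\<^bsub>M\<^esub> y) = h x \<oplus>\<^bsub>L\<^esub> h y" if "h \<in> H" "x \<in> carrier M" "y \<in> carrier M" for h x y
    using that by (intro lie_homD(2)[OF subsetD[OF hom]])
  have h_smult [simp]: "h (a \<odot>\<^bsub>M\<^esub> x) = a \<odot>\<^bsub>L\<^esub> h x" if "h \<in> H" "a \<in> carrier K" "x \<in> carrier M" for h a x
    using that by (intro lie_homD(3)[OF subsetD[OF hom]])
  \<comment> \<open>Negatives exist because they are the multiples by \<open>-1\<close>.\<close>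
  have "module K M"
  proof (intro moduleI abelian_groupI)
    fix x assume x: "x \<in> carrier M"
    have "(\<ominus>\<^bsub>K\<^esub> \<one>\<^bsub>K\<^esub>) \<odot>\<^bsub>M\<^esub> x \<oplus>\<^bsub>M\<^esub> x = \<zero>\<^bsub>M\<^esub>"
      using x by (intro separated) (auto simp: L.smult_l_minus L.l_neg)
    then show "\<exists>y\<in>carrier M. y \<oplus>\<^bsub>M\<^esub> x = \<zero>\<^bsub>M\<^esub>"
      using x by (intro bexI[of _ "(\<ominus>\<^bsub>K\<^esub> \<one>\<^bsub>K\<^esub>) \<odot>\<^bsub>M\<^esub> x"]) auto
  qed (auto intro!: separated module.axioms(1)[OF L.module_axioms]
        simp: L.a_ac L.smult_l_distr L.smult_r_distr L.smult_assoc1)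
  then interpret M: module K M .
  have ag: "abelian_group_hom M L h" if "h \<in> H" for h
    using that hom by (intro lie_hom_abelian_group_hom L.abelian_group_axioms M.abelian_group_axioms) auto
  have h_set: "set (map h ls) \<subseteq> carrier L" if "h \<in> H" "set ls \<subseteq> carrier M" for h ls
    using that by auto
  have h_bracket: "h (bracket M ls) = bracket L (map h ls)"
    if "h \<in> H" "length ls = n" "set ls \<subseteq> carrier M" for h ls
    using that by (intro lie_homD(4)[OF subsetD[OF hom]])
  have upd: "set (ls[i := x]) \<subseteq> carrier M" if "set ls \<subseteq> carrier M" "x \<in> carrier M" for ls i x
    using that set_update_subset_insert[of ls i x] by auto
  show ?thesis
  proof (intro lie_n_algebra.intro lie_n_algebra_axioms.intro)
    show "field K" "module K M" by unfold_locales
  next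
    fix ls i x y
    assume ls: "length ls = n" "set ls \<subseteq> carrier M" "i < n" and xy: "x \<in> carrier M" "y \<in> carrier M"
    show "bracket M (ls[i := x \<oplus>\<^bsub>M\<^esub> y]) = bracket M (ls[i := x]) \<oplus>\<^bsub>M\<^esub> bracket M (ls[i := y])"
      using ls xy
      by (intro separated)
         (auto simp: bracket upd h_bracket map_update L.bracket_add h_set simp del: set_map)
  next
    fix ls i a x
    assume ls: "length ls = n" "set ls \<subseteq> carrier M" "i < n" and ax: "a \<in> carrier K" "x \<in> carrier M"
    show "bracket M (ls[i := a \<odot>\<^bsub>M\<^esub> x]) = a \<odot>\<^bsub>M\<^esub> bracket M (ls[i := x])"
      using ls ax
      by (intro separated)
         (auto simp: bracket upd h_bracket map_update L.bracket_smult h_set simp del: set_map)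
  next
    fix ls ls'
    assume ls: "length ls = n" "set ls \<subseteq> carrier M" "length ls' = n - 1" "set ls' \<subseteq> carrier M"
    have nth: "ls ! i \<in> carrier M" if "i < n" for i
      using ls that by auto
    have inner: "length (ls ! i # ls') = n" "set (ls ! i # ls') \<subseteq> carrier M" if "i < n" for i
      using ls nth that by auto
    have step: "set (ls[i := bracket M (ls ! i # ls')]) \<subseteq> carrier M" if "i < n" for i
      using ls inner that by (intro upd bracket) auto
    have closed: "(\<lambda>i. bracket M (ls[i := bracket M (ls ! i # ls')])) \<in> {..<n} \<rightarrow> carrier M"
      using ls step by (auto intro!: bracket)
    have outer: "length (bracket M ls # ls') = n" "set (bracket M ls # ls') \<subseteq> carrier M"
      using ls n by (auto intro: bracket)
    show "bracket M (bracket M ls # ls') =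
      (\<Oplus>\<^bsub>M\<^esub>i\<in>{..<n}. bracket M (ls[i := bracket M (ls ! i # ls')]))"
    proof (intro separated ballI)
      fix h assume h: "h \<in> H"
      interpret h: abelian_group_hom M L h by (rule ag[OF h])
      have "h (bracket M (bracket M ls # ls')) =
          bracket L (bracket L (map h ls) # map h ls')"
        using h ls by (subst h_bracket[OF h outer]) (simp add: h_bracket)
      also have "\<dots> =
          (\<Oplus>\<^bsub>L\<^esub>i\<in>{..<n}. bracket L ((map h ls)[i := bracket L (map h ls ! i # map h ls')]))"
        using h ls by (intro L.bracket_derivation h_set) auto
      also have "\<dots> = (\<Oplus>\<^bsub>L\<^esub>i\<in>{..<n}. h (bracket M (ls[i := bracket M (ls ! i # ls')])))"
      proof (rule L.finsum_cong')
        show "(\<lambda>i. h (bracket M (ls[i := bracket M (ls ! i # ls')]))) \<in> {..<n} \<rightarrow> carrier L"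
          using closed h by (auto simp: Pi_def)
      next
        fix i assume "i \<in> {..<n}"
        then have i: "i < n" by simp
        show "bracket L ((map h ls)[i := bracket L (map h ls ! i # map h ls')]) =
            h (bracket M (ls[i := bracket M (ls ! i # ls')]))"
          using h ls i step[OF i] inner[OF i] by (simp add: h_bracket map_update)
      qed simp
      also have "\<dots> = h (\<Oplus>\<^bsub>M\<^esub>i\<in>{..<n}. bracket M (ls[i := bracket M (ls ! i # ls')]))"
        using closed by (simp add: h.hom_finsum)
      finally show "h (bracket M (bracket M ls # ls')) = \<dots>" .
    qed (use outer closed bracket in auto)
  next
    fix ls \<sigma>
    assume ls: "length ls = n" "set ls \<subseteq> carrier M" and \<sigma>: "\<sigma> permutes {..<n}"
    have p: "length (permute_list \<sigma> ls) = n" "set (permute_list \<sigma> ls) \<subseteq> carrier M"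
      using ls \<sigma> by auto
    have e: "map h (permute_list \<sigma> ls) = permute_list \<sigma> (map h ls)" for h
      using ls \<sigma> by (simp add: permute_list_map)
    show "bracket M ls = [sign \<sigma>] \<cdot>\<^bsub>M\<^esub> bracket M (permute_list \<sigma> ls)"
    proof (intro separated ballI)
      fix h assume h: "h \<in> H"
      interpret h: abelian_group_hom M L h by (rule ag[OF h])
      show "h (bracket M ls) = h ([sign \<sigma>] \<cdot>\<^bsub>M\<^esub> bracket M (permute_list \<sigma> ls))"
        using L.bracket_permute[of "map h ls" \<sigma>] h ls \<sigma> p
        by (simp add: h_bracket h.hom_add_pow_int bracket e h_set del: set_map)
    qed (use ls p bracket in \<open>auto intro!: M.add.int_pow_closed\<close>)
  qed (use bracket in auto)
qed

section \<open>Kernel pairs of higher arrows\<close>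

lemma fold_arrowD:
  assumes "fold_arrow n K m f"
  shows "I \<subseteq> {1..m} \<Longrightarrow> lie_n_algebra n K (obj f I)"
    and "I \<subseteq> J \<Longrightarrow> J \<subseteq> {1..m} \<Longrightarrow> mor f I J \<in> lie_hom n K (obj f I) (obj f J)"
    and "I \<subseteq> {1..m} \<Longrightarrow> x \<in> carrier (obj f I) \<Longrightarrow> mor f I I x = x"
    and "H \<subseteq> I \<Longrightarrow> I \<subseteq> J \<Longrightarrow> J \<subseteq> {1..m} \<Longrightarrow> x \<in> carrier (obj f H) \<Longrightarrow>
      mor f I J (mor f H I x) = mor f H J x"
  using assms by (auto simp: fold_arrow_def)

lemma fold_arrow_mor_hom:
  assumes "fold_arrow n K m f" "I \<subseteq> J" "J \<subseteq> {1..m}"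
  shows "abelian_group_hom (obj f I) (obj f J) (mor f I J)"
  using assms
  by (intro lie_hom_abelian_group_hom[of _ _ _ n K] fold_arrowD lie_n_algebra_abelian_group[of n K]) auto

lemma lie_n_algebra_leaf_alg:
  assumes n: "n > 0" and L: "lie_n_algebra n K L"
  shows "lie_n_algebra n K (leaf_alg L)"
proof -
  interpret L: lie_n_algebra n K L by fact
  have unleaf: "set (map unleaf ls) \<subseteq> carrier L" if "set ls \<subseteq> Leaf ` carrier L" for ls
    using that by fastforce
  show ?thesis
  proof (rule lie_n_algebra_if_separated[OF n L, where H = "{unleaf}"])
    show "{unleaf} \<subseteq> lie_hom n K (leaf_alg L) L"
      by (auto simp: lie_hom_def leaf_alg_def)
  next
    fix ls assume "length ls = n" "set ls \<subseteq> carrier (leaf_alg L)"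
    then show "bracket (leaf_alg L) ls \<in> carrier (leaf_alg L)"
      using L.bracket_closed[of "map unleaf ls"] unleaf[of ls]
      by (auto simp: leaf_alg_def simp del: set_map)
  qed (auto simp: leaf_alg_def)
qed

lemma fold_arrow_leaf_arrow:
  assumes "n > 0" and f: "fold_arrow n K m f"
  shows "fold_arrow n K m (leaf_arrow f)"
  unfolding fold_arrow_def
proof (intro conjI allI impI ballI)
  fix I assume "I \<subseteq> {1..m}"
  then show "lie_n_algebra n K (obj (leaf_arrow f) I)"
    using assms by (simp add: leaf_arrow_def lie_n_algebra_leaf_alg fold_arrowD(1))
next
  fix I J assume IJ: "I \<subseteq> J" "J \<subseteq> {1..m}"
  have h: "mor f I J \<in> lie_hom n K (obj f I) (obj f J)"
    using IJ by (rule fold_arrowD(2)[OF f])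
  have unleaf: "set (map unleaf ls) \<subseteq> carrier (obj f I)" if "set ls \<subseteq> Leaf ` carrier (obj f I)" for ls
    using that by fastforce
  show "mor (leaf_arrow f) I J \<in> lie_hom n K (obj (leaf_arrow f) I) (obj (leaf_arrow f) J)"
    unfolding lie_hom_def leaf_arrow_def leaf_alg_def
    by (auto simp: lie_homD(1-3)[OF h] lie_homD(4)[OF h _ unleaf] comp_def)
next
  fix I x assume "I \<subseteq> {1..m}" "x \<in> carrier (obj (leaf_arrow f) I)"
  then show "mor (leaf_arrow f) I I x = x"
    by (auto simp: leaf_arrow_def leaf_alg_def fold_arrowD(3)[OF f])
next
  fix H I J x assume "H \<subseteq> I" "I \<subseteq> J" "J \<subseteq> {1..m}" "x \<in> carrier (obj (leaf_arrow f) H)"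
  then show "mor (leaf_arrow f) I J (mor (leaf_arrow f) H I x) = mor (leaf_arrow f) H J x"
    by (auto simp: leaf_arrow_def leaf_alg_def fold_arrowD(4)[OF f])
qed

lemma Node_in_kernel_pair [simp]:
  "Node x y \<in> carrier (obj (kernel_pair m f) I) \<longleftrightarrow>
    x \<in> carrier (obj f I) \<and> y \<in> carrier (obj f I) \<and>
    mor f I (insert m I) x = mor f I (insert m I) y"
  by (simp add: kernel_pair_def)

lemma kernel_pair_carrierD:
  assumes "z \<in> carrier (obj (kernel_pair m f) I)"
  shows "left z \<in> carrier (obj f I)" "right z \<in> carrier (obj f I)"
    "mor f I (insert m I) (left z) = mor f I (insert m I) (right z)"
    "z = Node (left z) (right z)"
  using assms by (auto simp: kernel_pair_def)

lemma kernel_pair_list_carrier: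
  assumes "set zs \<subseteq> carrier (obj (kernel_pair m f) I)"
  shows "set (map left zs) \<subseteq> carrier (obj f I)" "set (map right zs) \<subseteq> carrier (obj f I)"
  using kernel_pair_carrierD(1,2)[OF subsetD[OF assms]] by auto

lemma lie_n_algebra_kernel_pair:
  assumes n: "n > 0"
    and L: "lie_n_algebra n K (obj f I)" and M: "lie_n_algebra n K (obj f (insert m I))"
    and h: "mor f I (insert m I) \<in> lie_hom n K (obj f I) (obj f (insert m I))"
  shows "lie_n_algebra n K (obj (kernel_pair m f) I)"
proof -
  interpret L: lie_n_algebra n K "obj f I" by fact
  interpret M: lie_n_algebra n K "obj f (insert m I)" by fact
  show ?thesis
  proof (rule lie_n_algebra_if_separated[OF n L, where H = "{left, right}"])
    show "{left, right} \<subseteq> lie_hom n K (obj (kernel_pair m f) I) (obj f I)"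
      by (auto simp: lie_hom_def kernel_pair_def)
  next
    fix zs assume zs: "length zs = n" "set zs \<subseteq> carrier (obj (kernel_pair m f) I)"
    have eq: "map (mor f I (insert m I)) (map left zs) = map (mor f I (insert m I)) (map right zs)"
      using kernel_pair_carrierD(3)[OF subsetD[OF zs(2)]] by simp
    have "mor f I (insert m I) (bracket (obj f I) (map left zs)) =
        mor f I (insert m I) (bracket (obj f I) (map right zs))"
      using zs(1) by (simp only: lie_homD(4)[OF h] kernel_pair_list_carrier[OF zs(2)] eq length_map)
    then show "bracket (obj (kernel_pair m f) I) zs \<in> carrier (obj (kernel_pair m f) I)"
      using zs(1) L.bracket_closed kernel_pair_list_carrier[OF zs(2)]
      by (simp add: kernel_pair_def del: set_map)
  qed (auto simp: kernel_pair_def lie_homD(1-3)[OF h] del: equalityI)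
qed

text \<open>This is what lets the recursion defining \<open>L\<^sub>m[f]\<close> be followed by induction: the kernel pair
  of a higher arrow is again one. The maps between kernel pairs are well defined because the
  squares formed by \<open>I \<subseteq> J\<close> and the direction \<open>m + 1\<close> commute.\<close>

lemma fold_arrow_kernel_pair:
  assumes n: "n > 0" and f: "fold_arrow n K (Suc m) f"
  shows "fold_arrow n K m (kernel_pair (Suc m) f)"
  unfolding fold_arrow_def
proof (intro conjI allI impI ballI)
  fix I assume "I \<subseteq> {1..m}"
  then have "insert (Suc m) I \<subseteq> {1..Suc m}" by auto
  then show "lie_n_algebra n K (obj (kernel_pair (Suc m) f) I)"
    by (intro lie_n_algebra_kernel_pair n fold_arrowD[OF f]) auto
next
  fix I J assume IJ: "I \<subseteq> J" "J \<subseteq> {1..m}"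
  have J: "insert (Suc m) J \<subseteq> {1..Suc m}" using IJ by auto
  have h: "mor f I J \<in> lie_hom n K (obj f I) (obj f J)"
    using IJ J by (intro fold_arrowD(2)[OF f]) auto
  have square: "mor f J (insert (Suc m) J) (mor f I J x) =
      mor f (insert (Suc m) I) (insert (Suc m) J) (mor f I (insert (Suc m) I) x)"
    if "x \<in> carrier (obj f I)" for x
    using IJ J that by (subst (1 2) fold_arrowD(4)[OF f]) auto
  show "mor (kernel_pair (Suc m) f) I J \<in>
      lie_hom n K (obj (kernel_pair (Suc m) f) I) (obj (kernel_pair (Suc m) f) J)"
    unfolding lie_hom_def
  proof (intro CollectI conjI ballI allI impI funcsetI)
    fix zs assume zs: "length zs = n" "set zs \<subseteq> carrier (obj (kernel_pair (Suc m) f) I)"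
    show "mor (kernel_pair (Suc m) f) I J (bracket (obj (kernel_pair (Suc m) f) I) zs) =
        bracket (obj (kernel_pair (Suc m) f) J) (map (mor (kernel_pair (Suc m) f) I J) zs)"
      using kernel_pair_list_carrier[OF zs(2)] zs(1)
      by (simp add: kernel_pair_def lie_homD(4)[OF h] comp_def del: set_map)
  qed (auto simp: kernel_pair_def lie_homD(1-3)[OF h] square)
next
  fix I x assume "I \<subseteq> {1..m}" "x \<in> carrier (obj (kernel_pair (Suc m) f) I)"
  moreover from this have "I \<subseteq> {1..Suc m}" by auto
  ultimately show "mor (kernel_pair (Suc m) f) I I x = x"
    by (auto simp: kernel_pair_def fold_arrowD(3)[OF f])
next
  fix H I J x
  assume "H \<subseteq> I" "I \<subseteq> J" "J \<subseteq> {1..m}" "x \<in> carrier (obj (kernel_pair (Suc m) f) H)"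
  moreover from this have "J \<subseteq> {1..Suc m}" by auto
  ultimately show "mor (kernel_pair (Suc m) f) I J (mor (kernel_pair (Suc m) f) H I x) =
      mor (kernel_pair (Suc m) f) H J x"
    by (auto simp: kernel_pair_def fold_arrowD(4)[OF f])
qed

section \<open>Brackets of elements of kernels\<close>

text \<open>The generators of all summands of the ideal in the theorem, taken together.\<close>

definition kernel_brackets :: "nat \<Rightarrow> nat \<Rightarrow> ('k, 'v) arrow \<Rightarrow> 'v set" where
  "kernel_brackets n m f =
     (\<Union>Is\<in>{Is. length Is = n \<and> \<Union>(set Is) = {1..m}}.
        bracket (obj f {}) ` listset (map (kernel_inter f) Is))"

lemma in_listset_iff: "xs \<in> listset As \<longleftrightarrow> list_all2 (\<in>) xs As"
  by (induction As arbitrary: xs) (auto simp: set_Cons_def list_all2_Cons2)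

lemma in_kernel_listset_iff:
  "xs \<in> listset (map (kernel_inter f) Is) \<longleftrightarrow>
    length xs = length Is \<and> (\<forall>i<length Is. xs ! i \<in> kernel_inter f (Is ! i))"
  by (auto simp: in_listset_iff list_all2_conv_all_nth)

lemma kernel_inter_iff:
  "x \<in> kernel_inter f I \<longleftrightarrow>
    x \<in> carrier (obj f {}) \<and> (\<forall>i\<in>I. mor f {} {i} x = \<zero>\<^bsub>obj f {i}\<^esub>)"
  by (auto simp: kernel_inter_def arrow_kernel_def a_kernel_def')

lemma kernel_listset_carrier:
  assumes "xs \<in> listset (map (kernel_inter f) Is)"
  shows "set xs \<subseteq> carrier (obj f {})"
  using assms by (auto simp: in_kernel_listset_iff in_set_conv_nth kernel_inter_iff)

text \<open>The kernels of the kernel pair are the restrictions of the kernels of \<open>f\<close> to pairs; for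
  \<open>x = 0\<close> the last condition says that \<open>y\<close> also lies in the kernel in direction \<open>m\<close>.\<close>

lemma Node_in_kernel_inter_kernel_pair:
  "Node x y \<in> kernel_inter (kernel_pair m f) I \<longleftrightarrow>
    x \<in> kernel_inter f I \<and> y \<in> kernel_inter f I \<and> mor f {} {m} x = mor f {} {m} y"
  by (auto simp: kernel_inter_iff) (auto simp: kernel_pair_def)

lemma zero_in_kernel_inter:
  assumes f: "fold_arrow n K m f" and I: "I \<subseteq> {1..m}"
  shows "\<zero>\<^bsub>obj f {}\<^esub> \<in> kernel_inter f I"
proof -
  interpret L: lie_n_algebra n K "obj f {}" by (rule fold_arrowD(1)[OF f]) simp
  show ?thesis
    using I by (auto simp: kernel_inter_iff intro!: abelian_group_hom.hom_zero fold_arrow_mor_hom[OF f])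
qed

text \<open>A pair in the kernel pair that lies in the kernels indexed by \<open>I\<close> has its difference in
  one more kernel. This is how the direction removed by the kernel pair enters the cover.\<close>

lemma diff_in_kernel_inter_insert:
  assumes f: "fold_arrow n K m f" and I: "insert j I \<subseteq> {1..m}"
    and x: "x \<in> kernel_inter f I" and y: "y \<in> kernel_inter f I"
    and eq: "mor f {} {j} x = mor f {} {j} y"
  shows "y \<ominus>\<^bsub>obj f {}\<^esub> x \<in> kernel_inter f (insert j I)"
proof -
  interpret L: lie_n_algebra n K "obj f {}" by (rule fold_arrowD(1)[OF f]) simp
  have "mor f {} {i} (y \<ominus>\<^bsub>obj f {}\<^esub> x) = \<zero>\<^bsub>obj f {i}\<^esub>" if i: "i \<in> insert j I" for i
  proof -
    interpret h: abelian_group_hom "obj f {}" "obj f {i}" "mor f {} {i}"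
      using i I by (intro fold_arrow_mor_hom[OF f]) auto
    show ?thesis
      using i x y eq h.H.r_neg[OF h.hom_closed, of y]
      by (auto simp: kernel_inter_iff L.minus_eq)
  qed
  then show ?thesis using x y by (simp add: kernel_inter_iff)
qed

lemma (in lie_n_algebra) bracket_zero:
  assumes "length ls = n" "set ls \<subseteq> carrier L" "\<zero>\<^bsub>L\<^esub> \<in> set ls"
  shows "bracket L ls = \<zero>\<^bsub>L\<^esub>"
proof -
  (* The zero argument is a multiple of the scalar 0, so homogeneity applies. *)
  obtain i where i: "i < n" "ls ! i = \<zero>\<^bsub>L\<^esub>"
    using assms by (auto simp: in_set_conv_nth)
  then have "bracket L ls = bracket L (ls[i := \<zero>\<^bsub>K\<^esub> \<odot>\<^bsub>L\<^esub> \<zero>\<^bsub>L\<^esub>])"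
    by (metis list_update_id smult_l_null zero_closed M.zero_closed)
  also have "\<dots> = \<zero>\<^bsub>K\<^esub> \<odot>\<^bsub>L\<^esub> bracket L (ls[i := \<zero>\<^bsub>L\<^esub>])"
    using assms i by (intro bracket_smult) auto
  also have "\<dots> = \<zero>\<^bsub>L\<^esub>"
    using assms i bracket_closed[of ls] by (metis list_update_id smult_l_null)
  finally show ?thesis .
qed

text \<open>The difference of two brackets telescopes: passing from \<open>xs\<close> to \<open>ys\<close> one entry at a time
  changes the bracket by a bracket that has the difference of two entries as an argument.\<close>

lemma (in lie_n_algebra) bracket_diff_in_submodule:
  assumes T: "submodule T K L"
    and xs: "length xs = n" "set xs \<subseteq> carrier L" and ys: "length ys = n" "set ys \<subseteq> carrier L"
    and change: "\<And>k. k < n \<Longrightarrow>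
      bracket L ((take k ys @ drop k xs)[k := ys ! k \<ominus>\<^bsub>L\<^esub> xs ! k]) \<in> T"
  shows "bracket L ys \<ominus>\<^bsub>L\<^esub> bracket L xs \<in> T"
proof -
  define u where "u k = take k ys @ drop k xs" for k
  have u: "length (u k) = n" "set (u k) \<subseteq> carrier L" if "k \<le> n" for k
    using that xs ys by (auto simp: u_def dest!: in_set_takeD in_set_dropD)
  have "bracket L (u k) \<ominus>\<^bsub>L\<^esub> bracket L xs \<in> T" if "k \<le> n" for k
    using that
  proof (induction k)
    case 0
    have "bracket L xs \<ominus>\<^bsub>L\<^esub> bracket L xs = \<zero>\<^bsub>L\<^esub>"
      using xs bracket_closed by (simp add: minus_eq r_neg)
    then show ?case
      using subgroup.one_closed[OF submodule.axioms(1)[OF T]] by (simp add: u_def)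
  next
    case (Suc k)
    then have k: "k < n" by simp
    have x: "xs ! k \<in> carrier L" and y: "ys ! k \<in> carrier L"
      using k xs ys by auto
    let ?d = "bracket L ((u k)[k := ys ! k \<ominus>\<^bsub>L\<^esub> xs ! k])"
    have "u (Suc k) = (u k)[k := ys ! k]"
      using k xs ys
      by (simp add: u_def take_Suc_conv_app_nth list_update_append flip: Cons_nth_drop_Suc)
    also have "ys ! k = (ys ! k \<ominus>\<^bsub>L\<^esub> xs ! k) \<oplus>\<^bsub>L\<^esub> xs ! k"
      using x y by (simp add: minus_eq a_assoc l_neg)
    finally have "bracket L (u (Suc k)) = ?d \<oplus>\<^bsub>L\<^esub> bracket L ((u k)[k := xs ! k])"
      using k x y u[of k] by (simp add: bracket_add)
    also have "(u k)[k := xs ! k] = u k"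
      using k xs ys by (simp add: u_def list_update_append flip: Cons_nth_drop_Suc)
    finally have step: "bracket L (u (Suc k)) = ?d \<oplus>\<^bsub>L\<^esub> bracket L (u k)" .
    have d: "?d \<in> T" using change[OF k] by (simp add: u_def)
    have "bracket L (u (Suc k)) \<ominus>\<^bsub>L\<^esub> bracket L xs =
        ?d \<oplus>\<^bsub>L\<^esub> (bracket L (u k) \<ominus>\<^bsub>L\<^esub> bracket L xs)"
      using step d submoduleE(1)[OF T] u[of k] xs bracket_closed k
      by (simp add: minus_eq a_assoc subset_iff)
    then show ?case
      using d Suc submoduleE(5)[OF T] by simp
  qed
  from this[of n] show ?thesis using xs ys by (simp add: u_def)
qed

section \<open>The ideal \<open>L\<^sub>m[f]\<close>\<close>

lemma finite_covers: "finite {Is. length Is = n \<and> \<Union>(set Is) = {1..m::nat}}"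
  by (rule finite_subset[OF _ finite_lists_length_eq[of "Pow {1..m}" n]]) auto

lemma lie_ideal_if_contains_all_brackets:
  assumes "\<And>ls. length ls = n \<Longrightarrow> set ls \<subseteq> carrier L \<Longrightarrow> bracket L ls \<in> T" "submodule T K L"
  shows "lie_ideal n K L T"
  using assms by (simp add: lie_ideal_def)

lemma bracket_in_bracket_ideal:
  assumes "xs \<in> listset Ns"
  shows "bracket L xs \<in> bracket_ideal n K L Ns"
  using assms by (auto simp: bracket_ideal_def gen_lie_ideal_def)

lemma bracket_ideal_subset:
  assumes "lie_ideal n K L T" "\<And>xs. xs \<in> listset Ns \<Longrightarrow> bracket L xs \<in> T"
  shows "bracket_ideal n K L Ns \<subseteq> T"
  using assms by (auto simp: bracket_ideal_def gen_lie_ideal_def)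

lemma kernel_inter_empty [simp]: "kernel_inter f {} = carrier (obj f {})"
  by (simp add: kernel_inter_def)

text \<open>Given a cover \<open>I\<^sub>1, \<dots>, I\<^sub>n\<close> of \<open>{1..m + 1}\<close> and \<open>x\<^sub>i\<close> in the kernels indexed by \<open>I\<^sub>i\<close>, lift
  \<open>x\<^sub>i\<close> to the kernel pair as \<open>(0, x\<^sub>i)\<close> when \<open>m + 1 \<in> I\<^sub>i\<close> and as \<open>(x\<^sub>i, x\<^sub>i)\<close> otherwise.
  The lifts lie in the kernels indexed by \<open>I\<^sub>i - {m + 1}\<close>, and their bracket is
  \<open>(0, [x\<^sub>1, \<dots>, x\<^sub>n])\<close> because at least one \<open>I\<^sub>i\<close> contains \<open>m + 1\<close>. By induction this pair
  lies in \<open>L\<^sub>m\<close> of the kernel pair.\<close>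

lemma kernel_brackets_subset_central_ideal:
  assumes n: "n > 0" and f: "fold_arrow n K m f"
  shows "kernel_brackets n m f \<subseteq> central_ideal n K m f"
  using f
proof (induction m arbitrary: f)
  case 0
  show ?case
  proof
    fix b assume "b \<in> kernel_brackets n 0 f"
    then obtain xs Is where b: "b = bracket (obj f {}) xs" and xs: "xs \<in> listset (map (kernel_inter f) Is)"
      and Is: "length Is = n"
      by (auto simp: kernel_brackets_def)
    have "xs \<in> listset (replicate n (carrier (obj f {})))"
      using xs Is by (auto simp: in_listset_iff list_all2_conv_all_nth kernel_inter_def)
    then show "b \<in> central_ideal n K 0 f"
      by (simp add: b bracket_in_bracket_ideal)
  qed
next
  case (Suc m)
  interpret L: lie_n_algebra n K "obj f {}" by (rule fold_arrowD(1)[OF Suc.prems]) simp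
  let ?R = "kernel_pair (Suc m) f"
  show ?case
  proof
    fix b assume "b \<in> kernel_brackets n (Suc m) f"
    then obtain xs Is where b: "b = bracket (obj f {}) xs"
      and xs: "xs \<in> listset (map (kernel_inter f) Is)"
      and Is: "length Is = n" "\<Union>(set Is) = {1..Suc m}"
      by (auto simp: kernel_brackets_def)
    have len: "length xs = n" and nth: "\<And>i. i < n \<Longrightarrow> xs ! i \<in> kernel_inter f (Is ! i)"
      using xs Is by (auto simp: in_kernel_listset_iff)
    have carrier: "set xs \<subseteq> carrier (obj f {})"
      using xs by (rule kernel_listset_carrier)
    have sub: "Is ! i \<subseteq> {1..Suc m}" if "i < n" for i
      using that Is by (metis Union_upper nth_mem)
    define zs where "zs = map (\<lambda>i. Node (if Suc m \<in> Is ! i then \<zero>\<^bsub>obj f {}\<^esub> else xs ! i) (xs ! i)) [0..<n]"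
    define Js where "Js = map (\<lambda>I. I - {Suc m}) Is"
    have "zs ! i \<in> kernel_inter ?R (Js ! i)" if i: "i < n" for i
    proof -
      have x: "xs ! i \<in> kernel_inter f (Is ! i - {Suc m})"
        using nth[OF i] by (auto simp: kernel_inter_iff)
      have zero: "\<zero>\<^bsub>obj f {}\<^esub> \<in> kernel_inter f {1..Suc m}"
        by (rule zero_in_kernel_inter[OF Suc.prems]) simp
      have "mor f {} {Suc m} \<zero>\<^bsub>obj f {}\<^esub> = mor f {} {Suc m} (xs ! i)" if "Suc m \<in> Is ! i"
        using that zero nth[OF i] by (auto simp: kernel_inter_iff)
      then show ?thesis
        using i Is x zero sub[OF i]
        by (auto simp: zs_def Js_def Node_in_kernel_inter_kernel_pair) (auto simp: kernel_inter_iff)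
    qed
    then have "zs \<in> listset (map (kernel_inter ?R) Js)"
      using Is unfolding in_kernel_listset_iff by (auto simp: zs_def Js_def)
    moreover have "\<Union>(set Js) = {1..m}"
    proof -
      have "\<Union>(set Js) = \<Union>(set Is) - {Suc m}" by (auto simp: Js_def)
      then show ?thesis using Is by auto
    qed
    ultimately have "bracket (obj ?R {}) zs \<in> kernel_brackets n m ?R"
      using Is unfolding kernel_brackets_def by (intro UN_I[of Js] imageI) (auto simp: Js_def)
    also have "\<dots> \<subseteq> central_ideal n K m ?R"
      using n Suc.prems by (intro Suc.IH fold_arrow_kernel_pair)
    also have "bracket (obj ?R {}) zs = Node \<zero>\<^bsub>obj f {}\<^esub> b"
    proof -
      have "Suc m \<in> \<Union>(set Is)" using Is by simp
      then obtain i where i: "i < n" "Suc m \<in> Is ! i" using Is(1) by (auto simp: in_set_conv_nth)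
      have "map left zs ! i = \<zero>\<^bsub>obj f {}\<^esub>" using i by (simp add: zs_def)
      moreover have "length (map left zs) = n" by (simp add: zs_def)
      ultimately have "\<zero>\<^bsub>obj f {}\<^esub> \<in> set (map left zs)" using i by (metis nth_mem)
      moreover have "set (map left zs) \<subseteq> carrier (obj f {})"
        using carrier len by (auto simp: zs_def)
      ultimately have "bracket (obj f {}) (map left zs) = \<zero>\<^bsub>obj f {}\<^esub>"
        by (intro L.bracket_zero) (auto simp: zs_def)
      moreover have "map right zs = xs"
        using len by (auto simp: zs_def intro: nth_equalityI)
      ultimately show ?thesis by (simp add: kernel_pair_def b)
    qed
    finally show "b \<in> central_ideal n K (Suc m) f"
      using L.bracket_closed[OF len carrier] by (simp add: b)
  qed
qed

text \<open>Taking the difference of the two components is linear on the kernel pair, so preimages of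
  submodules are submodules. Together with the next lemma this carries an upper bound for the
  brackets of \<open>f\<close> over to an upper bound for the brackets of its kernel pair.\<close>

lemma difference_submodule:
  assumes n: "n > 0" and f: "fold_arrow n K (Suc m) f" and T: "submodule T K (obj f {})"
  shows "submodule {z \<in> carrier (obj (kernel_pair (Suc m) f) {}). right z \<ominus>\<^bsub>obj f {}\<^esub> left z \<in> T}
    K (obj (kernel_pair (Suc m) f) {})" (is "submodule ?D K ?R")
proof -
  interpret L: lie_n_algebra n K "obj f {}" by (rule fold_arrowD(1)[OF f]) simp
  interpret R: lie_n_algebra n K ?R
    by (rule fold_arrowD(1)[OF fold_arrow_kernel_pair[OF n f]]) simp
  have smult: "a \<odot>\<^bsub>?R\<^esub> z \<in> ?D" if a: "a \<in> carrier K" and z: "z \<in> ?D" for a z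
  proof -
    have z': "z \<in> carrier ?R" using z by simp
    note c = kernel_pair_carrierD[OF z']
    have "right (a \<odot>\<^bsub>?R\<^esub> z) \<ominus>\<^bsub>obj f {}\<^esub> left (a \<odot>\<^bsub>?R\<^esub> z) =
        a \<odot>\<^bsub>obj f {}\<^esub> (right z \<ominus>\<^bsub>obj f {}\<^esub> left z)"
      using a c by (simp add: kernel_pair_def L.minus_eq L.smult_r_distr L.smult_r_minus)
    then show ?thesis
      using a z z' L.submoduleE(4)[OF T] by (simp add: R.smult_closed)
  qed
  show ?thesis
  proof (rule R.submoduleI)
    show "\<zero>\<^bsub>?R\<^esub> \<in> ?D"
      using subgroup.one_closed[OF submodule.axioms(1)[OF T]] R.zero_closed
        L.submoduleE(3)[OF T]
      by (simp add: kernel_pair_def L.minus_eq)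
  next
    fix z assume z: "z \<in> ?D"
    then have "\<ominus>\<^bsub>?R\<^esub> z = (\<ominus>\<^bsub>K\<^esub> \<one>\<^bsub>K\<^esub>) \<odot>\<^bsub>?R\<^esub> z"
      by (simp add: R.smult_l_minus)
    then show "\<ominus>\<^bsub>?R\<^esub> z \<in> ?D" using smult z by simp
  next
    fix z w assume zw: "z \<in> ?D" "w \<in> ?D"
    then have zw': "z \<in> carrier ?R" "w \<in> carrier ?R" by auto
    note c = kernel_pair_carrierD[OF zw'(1)] kernel_pair_carrierD[OF zw'(2)]
    have "right (z \<oplus>\<^bsub>?R\<^esub> w) \<ominus>\<^bsub>obj f {}\<^esub> left (z \<oplus>\<^bsub>?R\<^esub> w) =
        (right z \<ominus>\<^bsub>obj f {}\<^esub> left z) \<oplus>\<^bsub>obj f {}\<^esub> (right w \<ominus>\<^bsub>obj f {}\<^esub> left w)"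
      using c by (simp add: kernel_pair_def L.minus_eq L.minus_add L.a_ac)
    then show "z \<oplus>\<^bsub>?R\<^esub> w \<in> ?D"
      using zw zw' L.submoduleE(5)[OF T] by (simp add: R.add.m_closed)
  qed (use smult in auto)
qed

text \<open>The two components of a bracket in the kernel pair are brackets of \<open>x\<^sub>i\<close> and of \<open>y\<^sub>i\<close>.
  Exchanging \<open>x\<^sub>i\<close> for \<open>y\<^sub>i\<close> one index at a time, each change is a bracket with
  \<open>y\<^sub>i - x\<^sub>i\<close> as its \<open>i\<close>-th argument. This difference lies in the kernel in direction \<open>m + 1\<close>, so
  enlarging the \<open>i\<close>-th set of the cover by \<open>m + 1\<close> gives a cover of \<open>{1..m + 1}\<close>.\<close>

lemma kernel_brackets_kernel_pair_diff:
  assumes n: "n > 0" and f: "fold_arrow n K (Suc m) f"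
    and T: "submodule T K (obj f {})" "kernel_brackets n (Suc m) f \<subseteq> T"
    and b: "b \<in> kernel_brackets n m (kernel_pair (Suc m) f)"
  shows "b \<in> carrier (obj (kernel_pair (Suc m) f) {})"
    and "right b \<ominus>\<^bsub>obj f {}\<^esub> left b \<in> T"
proof -
  let ?R = "kernel_pair (Suc m) f"
  interpret L: lie_n_algebra n K "obj f {}" by (rule fold_arrowD(1)[OF f]) simp
  interpret R: lie_n_algebra n K "obj ?R {}"
    by (rule fold_arrowD(1)[OF fold_arrow_kernel_pair[OF n f]]) simp
  obtain zs Is where b: "b = bracket (obj ?R {}) zs"
    and zs: "zs \<in> listset (map (kernel_inter ?R) Is)"
    and Is: "length Is = n" "\<Union>(set Is) = {1..m}"
    using b by (auto simp: kernel_brackets_def)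
  have len: "length zs = n" using zs Is by (simp add: in_kernel_listset_iff)
  have carrier: "set zs \<subseteq> carrier (obj ?R {})" using zs by (rule kernel_listset_carrier)
  then show "b \<in> carrier (obj ?R {})" using len R.bracket_closed by (simp add: b)
  define xs ys where "xs = map left zs" and "ys = map right zs"
  have lens: "length xs = n" "length ys = n" by (simp_all add: xs_def ys_def len)
  have xys: "xs ! i \<in> kernel_inter f (Is ! i)" "ys ! i \<in> kernel_inter f (Is ! i)"
    "mor f {} {Suc m} (xs ! i) = mor f {} {Suc m} (ys ! i)" if i: "i < n" for i
  proof -
    have z: "zs ! i \<in> kernel_inter ?R (Is ! i)" using i zs Is by (simp add: in_kernel_listset_iff)
    then have "zs ! i \<in> carrier (obj ?R {})" by (simp add: kernel_inter_iff)
    then have "zs ! i = Node (xs ! i) (ys ! i)"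
      using kernel_pair_carrierD(4) i len by (simp add: xs_def ys_def)
    then show "xs ! i \<in> kernel_inter f (Is ! i)" "ys ! i \<in> kernel_inter f (Is ! i)"
      "mor f {} {Suc m} (xs ! i) = mor f {} {Suc m} (ys ! i)"
      using z by (auto simp: Node_in_kernel_inter_kernel_pair)
  qed
  have sub: "Is ! i \<subseteq> {1..m}" if "i < n" for i
    using that Is by (metis Union_upper nth_mem)
  have "bracket (obj f {}) ys \<ominus>\<^bsub>obj f {}\<^esub> bracket (obj f {}) xs \<in> T"
  proof (rule L.bracket_diff_in_submodule[OF T(1)])
    show "set xs \<subseteq> carrier (obj f {})" "set ys \<subseteq> carrier (obj f {})"
      using kernel_pair_list_carrier[OF carrier] by (simp_all add: xs_def ys_def)
  next
    fix k assume k: "k < n"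
    let ?us = "(take k ys @ drop k xs)[k := ys ! k \<ominus>\<^bsub>obj f {}\<^esub> xs ! k]"
    let ?Js = "Is[k := insert (Suc m) (Is ! k)]"
    have "insert (Suc m) (Is ! k) \<subseteq> {1..Suc m}" using sub[OF k] by auto
    then have "ys ! k \<ominus>\<^bsub>obj f {}\<^esub> xs ! k \<in> kernel_inter f (insert (Suc m) (Is ! k))"
      using xys[OF k] by (intro diff_in_kernel_inter_insert[OF f])
    then have "?us \<in> listset (map (kernel_inter f) ?Js)"
      using k lens Is xys by (auto simp: in_kernel_listset_iff nth_list_update nth_append)
    moreover have "\<Union>(set ?Js) = {1..Suc m}"
    proof -
      have "\<Union>(set ?Js) = insert (Suc m) (\<Union>(set Is))"
        using k Is(1) by (auto simp: set_conv_nth nth_list_update split: if_splits)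
      then show ?thesis using Is by auto
    qed
    ultimately have "bracket (obj f {}) ?us \<in> kernel_brackets n (Suc m) f"
      using Is unfolding kernel_brackets_def
      by (intro UN_I[of ?Js] imageI) auto
    then show "bracket (obj f {}) ?us \<in> T" using T(2) by auto
  qed (use lens in auto)
  then show "right b \<ominus>\<^bsub>obj f {}\<^esub> left b \<in> T"
    by (simp add: b kernel_pair_def xs_def ys_def)
qed

text \<open>The upper bound matching \<open>kernel_brackets_subset_central_ideal\<close>. The case \<open>m = 0\<close> holds
  because a submodule that contains every bracket is an ideal. In the inductive step, the
  bound obtained for the kernel pair is evaluated at the pairs \<open>(0, k)\<close>, whose difference is \<open>k\<close>.\<close>

lemma central_ideal_subset:
  assumes n: "n > 0" and f: "fold_arrow n K m f"
    and T: "submodule T K (obj f {})" "kernel_brackets n m f \<subseteq> T"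
  shows "central_ideal n K m f \<subseteq> T"
  using f T
proof (induction m arbitrary: f T)
  case 0
  have "bracket (obj f {}) xs \<in> T" if "length xs = n" "set xs \<subseteq> carrier (obj f {})" for xs
  proof -
    have "xs \<in> listset (map (kernel_inter f) (replicate n {}))"
      using that by (auto simp: in_listset_iff list_all2_conv_all_nth)
    then have "bracket (obj f {}) xs \<in> kernel_brackets n 0 f"
      using n unfolding kernel_brackets_def
      by (intro UN_I[of "replicate n {}"] imageI) auto
    then show ?thesis using 0 by auto
  qed
  note bracket = this
  have "bracket_ideal n K (obj f {}) (replicate n (carrier (obj f {}))) \<subseteq> T"
  proof (rule bracket_ideal_subset)
    show "lie_ideal n K (obj f {}) T"
      using bracket 0 by (intro lie_ideal_if_contains_all_brackets)
  next
    fix xs assume "xs \<in> listset (replicate n (carrier (obj f {})))"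
    then show "bracket (obj f {}) xs \<in> T"
      by (intro bracket) (auto simp: in_listset_iff list_all2_conv_all_nth in_set_conv_nth)
  qed
  then show ?case by simp
next
  case (Suc m)
  let ?R = "kernel_pair (Suc m) f"
  interpret L: lie_n_algebra n K "obj f {}" by (rule fold_arrowD(1)[OF Suc.prems(1)]) simp
  have diff: "central_ideal n K m ?R \<subseteq>
      {z \<in> carrier (obj ?R {}). right z \<ominus>\<^bsub>obj f {}\<^esub> left z \<in> T}"
    using kernel_brackets_kernel_pair_diff[OF n Suc.prems]
    by (intro Suc.IH[OF fold_arrow_kernel_pair[OF n Suc.prems(1)]
          difference_submodule[OF n Suc.prems(1,2)]]) blast
  show ?case
  proof
    fix x assume "x \<in> central_ideal n K (Suc m) f"
    then have x: "x \<in> carrier (obj f {})" "Node \<zero>\<^bsub>obj f {}\<^esub> x \<in> central_ideal n K m ?R"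
      by simp_all
    have "x \<ominus>\<^bsub>obj f {}\<^esub> \<zero>\<^bsub>obj f {}\<^esub> \<in> T"
      using subsetD[OF diff x(2)] by simp
    moreover have "\<ominus>\<^bsub>obj f {}\<^esub> \<zero>\<^bsub>obj f {}\<^esub> = \<zero>\<^bsub>obj f {}\<^esub>"
      by (metis L.a_inv_closed L.l_zero L.r_neg L.zero_closed)
    ultimately show "x \<in> T"
      using x(1) by (simp add: L.minus_eq)
  qed
qed

section \<open>Centrality\<close>

lemma kernel_brackets_leaf_arrow:
  "kernel_brackets n m (leaf_arrow f) = Leaf ` kernel_brackets n m f"
proof -
  have inter: "kernel_inter (leaf_arrow f) I = Leaf ` kernel_inter f I" for I
    by (auto simp: kernel_inter_iff leaf_arrow_def leaf_alg_def)
  have "listset (map (kernel_inter (leaf_arrow f)) Is) = map Leaf ` listset (map (kernel_inter f) Is)" for Is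
    by (induction Is) (auto simp: inter set_Cons_def intro!: image_eqI[where x = "y # ys" for y ys])
  moreover have "bracket (obj (leaf_arrow f) {}) (map Leaf xs) = Leaf (bracket (obj f {}) xs)" for xs
    by (simp add: leaf_arrow_def leaf_alg_def comp_def)
  ultimately show ?thesis
    by (simp add: kernel_brackets_def image_image image_UN)
qed

lemma (in lie_n_algebra) lie_ideal_zero: "lie_ideal n K L {\<zero>\<^bsub>L\<^esub>}"
proof -
  have "submodule {\<zero>\<^bsub>L\<^esub>} K L" by (rule submoduleI) auto
  moreover have "bracket L ls \<in> {\<zero>\<^bsub>L\<^esub>}"
    if "length ls = n" "set ls \<subseteq> carrier L" "i < n" "ls ! i \<in> {\<zero>\<^bsub>L\<^esub>}" for ls i
    using that nth_mem[of i ls] by (simp add: bracket_zero)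
  ultimately show ?thesis by (auto simp: lie_ideal_def)
qed

lemma (in lie_n_algebra) zero_in_bracket_ideal: "\<zero>\<^bsub>L\<^esub> \<in> bracket_ideal n K L Ns"
proof -
  have "\<zero>\<^bsub>L\<^esub> \<in> N" if "submodule N K L" for N
    using subgroup.one_closed[OF submodule.axioms(1)[OF that]] by simp
  then show ?thesis by (auto simp: bracket_ideal_def gen_lie_ideal_def lie_ideal_def)
qed

text \<open>A sum of ideals vanishes if and only if each summand does, and since the zero submodule is
  an ideal, a generated ideal vanishes if and only if its generators do.\<close>

lemma kernel_bracket_sum_zero_iff:
  assumes f: "fold_arrow n K m f"
  shows "kernel_bracket_sum n K m f = {\<zero>\<^bsub>obj f {}\<^esub>} \<longleftrightarrow> kernel_brackets n m f \<subseteq> {\<zero>\<^bsub>obj f {}\<^esub>}"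
proof -
  interpret L: lie_n_algebra n K "obj f {}" by (rule fold_arrowD(1)[OF f]) simp
  let ?covers = "{Is. length Is = n \<and> \<Union>(set Is) = {1..m}}"
  let ?N = "\<lambda>Is. bracket_ideal n K (obj f {}) (map (kernel_inter f) Is)"
  show ?thesis
  proof
    assume sum: "kernel_bracket_sum n K m f = {\<zero>\<^bsub>obj f {}\<^esub>}"
    show "kernel_brackets n m f \<subseteq> {\<zero>\<^bsub>obj f {}\<^esub>}"
    proof
      fix b assume "b \<in> kernel_brackets n m f"
      then obtain xs Is where b: "b = bracket (obj f {}) xs"
        and xs: "xs \<in> listset (map (kernel_inter f) Is)" and Is: "Is \<in> ?covers"
        by (auto simp: kernel_brackets_def)
      have closed: "b \<in> carrier (obj f {})"
        using xs Is L.bracket_closed kernel_listset_carrier[OF xs]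
        by (simp add: b in_kernel_listset_iff)
      (* The family concentrated at Is exhibits b as an element of the sum. *)
      define x where "x Js = (if Is = Js then b else \<zero>\<^bsub>obj f {}\<^esub>)" for Js
      have "x \<in> Pi ?covers ?N"
      proof
        fix Js
        show "x Js \<in> ?N Js"
          using bracket_in_bracket_ideal[OF xs, where n = n and K = K and L = "obj f {}"]
          by (cases "Is = Js") (simp_all add: x_def b L.zero_in_bracket_ideal)
      qed
      then have "(\<Oplus>\<^bsub>obj f {}\<^esub>Is\<in>?covers. x Is) \<in> kernel_bracket_sum n K m f"
        unfolding kernel_bracket_sum_def sum_family_def by (intro CollectI exI[of _ x]) simp
      moreover have "(\<Oplus>\<^bsub>obj f {}\<^esub>Is\<in>?covers. x Is) = b"
        using L.finsum_singleton[OF Is finite_covers, of "\<lambda>_. b"] closed by (simp add: x_def)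
      ultimately show "b \<in> {\<zero>\<^bsub>obj f {}\<^esub>}" using sum by simp
    qed
  next
    assume zero: "kernel_brackets n m f \<subseteq> {\<zero>\<^bsub>obj f {}\<^esub>}"
    have N: "?N Is = {\<zero>\<^bsub>obj f {}\<^esub>}" if "Is \<in> ?covers" for Is
    proof
      show "?N Is \<subseteq> {\<zero>\<^bsub>obj f {}\<^esub>}"
        using that zero
        by (intro bracket_ideal_subset L.lie_ideal_zero) (auto simp: kernel_brackets_def)
    qed (simp add: L.zero_in_bracket_ideal)
    have sum: "(\<Oplus>\<^bsub>obj f {}\<^esub>Is\<in>?covers. x Is) = \<zero>\<^bsub>obj f {}\<^esub>" if x: "x \<in> Pi ?covers ?N" for x
    proof (rule L.add.finprod_one_eqI)
      fix Is assume "Is \<in> ?covers"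
      then show "x Is = \<zero>\<^bsub>obj f {}\<^esub>" using N[of Is] Pi_mem[OF x, of Is] by blast
    qed
    have family: "(\<lambda>_. \<zero>\<^bsub>obj f {}\<^esub>) \<in> Pi ?covers ?N"
      by (intro Pi_I L.zero_in_bracket_ideal)
    show "kernel_bracket_sum n K m f = {\<zero>\<^bsub>obj f {}\<^esub>}"
      unfolding kernel_bracket_sum_def sum_family_def
    proof (intro equalityI subsetI)
      fix b assume "b \<in> {\<zero>\<^bsub>obj f {}\<^esub>}"
      then have "b = (\<Oplus>\<^bsub>obj f {}\<^esub>Is\<in>?covers. \<zero>\<^bsub>obj f {}\<^esub>)"
        by (simp only: sum[OF family] singleton_iff)
      then show "b \<in> {(\<Oplus>\<^bsub>obj f {}\<^esub>Is\<in>?covers. x Is) |x. x \<in> Pi ?covers ?N}"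
        using family by (intro CollectI exI[of _ "\<lambda>_. \<zero>\<^bsub>obj f {}\<^esub>"] conjI)
    qed (use sum in blast)
  qed
qed

text \<open>If the projections agree on \<open>L\<^sub>m\<close> of the kernel pair, then \<open>L\<^sub>m\<^sub>+\<^sub>1[f]\<close>, which consists of
  the \<open>k\<close> with \<open>(0, k)\<close> in it, is zero, and so are the brackets that it contains. Conversely, if
  the brackets are zero, the zero submodule is an upper bound for them, so all differences of
  components on \<open>L\<^sub>m\<close> of the kernel pair are zero.\<close>

lemma projections_agree_iff:
  assumes n: "n > 0" and f: "fold_arrow n K (Suc m) f"
  shows "(\<forall>z\<in>central_ideal n K m (kernel_pair (Suc m) f). left z = right z) \<longleftrightarrow>
    kernel_brackets n (Suc m) f \<subseteq> {\<zero>\<^bsub>obj f {}\<^esub>}"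
proof -
  let ?R = "kernel_pair (Suc m) f"
  interpret L: lie_n_algebra n K "obj f {}" by (rule fold_arrowD(1)[OF f]) simp
  show ?thesis
  proof
    assume agree: "\<forall>z\<in>central_ideal n K m ?R. left z = right z"
    then have "central_ideal n K (Suc m) f \<subseteq> {\<zero>\<^bsub>obj f {}\<^esub>}" by auto
    then show "kernel_brackets n (Suc m) f \<subseteq> {\<zero>\<^bsub>obj f {}\<^esub>}"
      using kernel_brackets_subset_central_ideal[OF n f] by (rule subset_trans[rotated])
  next
    assume zero: "kernel_brackets n (Suc m) f \<subseteq> {\<zero>\<^bsub>obj f {}\<^esub>}"
    have sub: "submodule {\<zero>\<^bsub>obj f {}\<^esub>} K (obj f {})"
      using L.lie_ideal_zero by (simp add: lie_ideal_def)
    have "central_ideal n K m ?R \<subseteq>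
        {z \<in> carrier (obj ?R {}). right z \<ominus>\<^bsub>obj f {}\<^esub> left z \<in> {\<zero>\<^bsub>obj f {}\<^esub>}}"
      using kernel_brackets_kernel_pair_diff[OF n f sub zero]
      by (intro central_ideal_subset[OF n fold_arrow_kernel_pair[OF n f]
            difference_submodule[OF n f sub]]) blast
    moreover have "left z = right z"
      if "z \<in> carrier (obj ?R {})" "right z \<ominus>\<^bsub>obj f {}\<^esub> left z = \<zero>\<^bsub>obj f {}\<^esub>" for z
    proof -
      note c = kernel_pair_carrierD[OF that(1)]
      then have "right z = (right z \<ominus>\<^bsub>obj f {}\<^esub> left z) \<oplus>\<^bsub>obj f {}\<^esub> left z"
        by (simp only: L.minus_eq L.a_assoc L.a_inv_closed L.l_neg L.r_zero)
      then show ?thesis using that(2) c by simp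
    qed
    ultimately show "\<forall>z\<in>central_ideal n K m ?R. left z = right z" by blast
  qed
qed

theorem proposition4p1:
  fixes K :: "('k, 'c) ring_scheme"
    and n m :: nat
    and f :: "('k, 'v) arrow"
  assumes "n \<ge> 2"
    and "field K"
    and "\<one>\<^bsub>K\<^esub> \<oplus>\<^bsub>K\<^esub> \<one>\<^bsub>K\<^esub> \<noteq> \<zero>\<^bsub>K\<^esub>"
    and "m \<ge> 1"
    and "fold_extension n K m f"
  shows "central_extension n K m f \<longleftrightarrow> kernel_bracket_sum n K m f = {\<zero>\<^bsub>obj f {}\<^esub>}"
proof -
  have n: "n > 0" using assms(1) by simp
  obtain k where m: "m = Suc k" using assms(4) by (cases m) auto
  have f: "fold_arrow n K m f" using assms(5) by (simp add: fold_extension_def)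
  have "central_extension n K m f \<longleftrightarrow>
      kernel_brackets n m (leaf_arrow f) \<subseteq> {\<zero>\<^bsub>obj (leaf_arrow f) {}\<^esub>}"
    using projections_agree_iff[OF n fold_arrow_leaf_arrow[OF n f[unfolded m]]]
    by (simp add: central_extension_def m)
  also have "\<zero>\<^bsub>obj (leaf_arrow f) {}\<^esub> = Leaf \<zero>\<^bsub>obj f {}\<^esub>"
    by (simp add: leaf_arrow_def leaf_alg_def)
  also have "kernel_brackets n m (leaf_arrow f) \<subseteq> {Leaf \<zero>\<^bsub>obj f {}\<^esub>} \<longleftrightarrow>
      kernel_brackets n m f \<subseteq> {\<zero>\<^bsub>obj f {}\<^esub>}"
    by (auto simp: kernel_brackets_leaf_arrow)
  also have "\<dots> \<longleftrightarrow> kernel_bracket_sum n K m f = {\<zero>\<^bsub>obj f {}\<^esub>}"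
    by (rule kernel_bracket_sum_zero_iff[OF f, symmetric])
  finally show ?thesis .
qed

end
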